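(* Let $G=(V,E)$ be a finite, connected, undirected graph (multiple edges allowed) with at least one edge, let $J\subseteq E$ be a critical set for $G$, let $V_1,\dots,V_k$ be the vertex sets of the $k$ connected components of $(V,E\setminus J)$, and for each $i$ let $E_i$ be the set of edges of $G$ with both endpoints in $V_i$ and $G_i=(V_i,E_i)$. Let $\eta^*$ be the optimal edge usage probabilities for $G$ and $\eta^*_i$ the optimal edge usage probabilities for $G_i$. Then for every $i$ and every $e\in E_i$, $\eta^*(e)=\eta^*_i(e)$.
   Context: For a graph $H$ with set of spanning trees $\Gamma_H$ (each viewed as a set of edges) and a probability mass function (pmf) $\mu$ on $\Gamma_H$, the edge usage probabilities are $\eta(e)=\sum_{\gamma\in\Gamma_H:\,e\in\gamma}\mu(\gamma)$. The Fairest Edge Usage problem on $H$ is to minimize $\sum_{e}\eta(e)^2$ over all pmfs on $\Gamma_H$; all minimizers induce the same edge usage probabilities, called the optimal edge usage probabilities of $H$ (for $H$ with no edges this is the empty function). With $\Gamma$ the spanning trees of $G$: for $J\subseteq E$, $\mathcal{M}(J)=\min_{\gamma\in\Gamma}|\gamma\cap J|$, $\theta(J)=\mathcal{M}(J)/|J|$ if $J\neq\emptyset$, $\theta(\emptyset)=0$; $\theta(G)=\max_{J\subseteq E}\theta(J)$, and $J$ is critical if $\theta(J)=\theta(G)$. *)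

theory Defs
  imports "HOL-Probability.Probability"
begin

text \<open>
  Edges are abstract objects with a two-element set of end vertices, so that parallel edges
  are permitted and loops are not.
\<close>

record ('v, 'e) mgraph =
  verts :: "'v set"
  edges :: "'e set"
  ends :: "'e \<Rightarrow> 'v set"

definition finite_mgraph :: "('v, 'e) mgraph \<Rightarrow> bool" where
  "finite_mgraph G \<longleftrightarrow> finite (verts G) \<and> finite (edges G) \<and>
     (\<forall>e\<in>edges G. ends G e \<subseteq> verts G \<and> card (ends G e) = 2)"

definition adj_rel :: "('v, 'e) mgraph \<Rightarrow> ('v \<times> 'v) set" where
  "adj_rel G = {(u, v). \<exists>e\<in>edges G. ends G e = {u, v}}"

definition reach_rel :: "('v, 'e) mgraph \<Rightarrow> ('v \<times> 'v) set" where
  "reach_rel G = {(u, v). u \<in> verts G \<and> v \<in> verts G \<and> (u, v) \<in> (adj_rel G)\<^sup>*}"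

definition connected_mgraph :: "('v, 'e) mgraph \<Rightarrow> bool" where
  "connected_mgraph G \<longleftrightarrow> verts G \<noteq> {} \<and> (\<forall>u\<in>verts G. \<forall>v\<in>verts G. (u, v) \<in> reach_rel G)"

definition component_verts :: "('v, 'e) mgraph \<Rightarrow> 'v set set" where
  "component_verts G = verts G // reach_rel G"

definition induced_mgraph :: "('v, 'e) mgraph \<Rightarrow> 'v set \<Rightarrow> ('v, 'e) mgraph" where
  "induced_mgraph G U = \<lparr>verts = U, edges = {e \<in> edges G. ends G e \<subseteq> U}, ends = ends G\<rparr>"

text \<open>
  Distinctness of the edges matters only for cycles of length two, which must consist
  of two different parallel edges.
\<close>

definition is_cycle :: "('v, 'e) mgraph \<Rightarrow> 'v list \<Rightarrow> 'e list \<Rightarrow> bool" where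
  "is_cycle G vs es \<longleftrightarrow> es \<noteq> [] \<and> length vs = length es \<and> distinct vs \<and> distinct es \<and>
     set es \<subseteq> edges G \<and>
     (\<forall>i<length es. ends G (es ! i) = {vs ! i, vs ! (Suc i mod length es)})"

definition acyclic_mgraph :: "('v, 'e) mgraph \<Rightarrow> bool" where
  "acyclic_mgraph G \<longleftrightarrow> (\<nexists>vs es. is_cycle G vs es)"

definition spanning_trees :: "('v, 'e) mgraph \<Rightarrow> 'e set set" where
  "spanning_trees G = {T. T \<subseteq> edges G \<and>
     connected_mgraph (G\<lparr>edges := T\<rparr>) \<and> acyclic_mgraph (G\<lparr>edges := T\<rparr>)}"

definition edge_usage :: "('v, 'e) mgraph \<Rightarrow> 'e set pmf \<Rightarrow> 'e \<Rightarrow> real" where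
  "edge_usage G \<mu> e = (\<Sum>T\<in>{T \<in> spanning_trees G. e \<in> T}. pmf \<mu> T)"

definition feu_minimizer :: "('v, 'e) mgraph \<Rightarrow> 'e set pmf \<Rightarrow> bool" where
  "feu_minimizer G \<mu> \<longleftrightarrow>
     is_arg_min (\<lambda>\<nu>. \<Sum>e\<in>edges G. (edge_usage G \<nu> e)\<^sup>2)
       (\<lambda>\<nu>. set_pmf \<nu> \<subseteq> spanning_trees G) \<mu>"

text \<open>
  For a finite connected graph the description below is uniquely satisfied, since every
  edge usage function vanishes outside the edge set.
\<close>

definition optimal_edge_usage :: "('v, 'e) mgraph \<Rightarrow> 'e \<Rightarrow> real" where
  "optimal_edge_usage G = (THE \<eta>. \<exists>\<mu>. feu_minimizer G \<mu> \<and> \<eta> = edge_usage G \<mu>)"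

definition min_overlap :: "('v, 'e) mgraph \<Rightarrow> 'e set \<Rightarrow> nat" where
  "min_overlap G J = Min ((\<lambda>T. card (T \<inter> J)) ` spanning_trees G)"

definition theta_set :: "('v, 'e) mgraph \<Rightarrow> 'e set \<Rightarrow> real" where
  "theta_set G J = (if J = {} then 0 else real (min_overlap G J) / real (card J))"

definition theta_graph :: "('v, 'e) mgraph \<Rightarrow> real" where
  "theta_graph G = Max (theta_set G ` Pow (edges G))"

definition critical_set :: "('v, 'e) mgraph \<Rightarrow> 'e set \<Rightarrow> bool" where
  "critical_set G J \<longleftrightarrow> J \<subseteq> edges G \<and> theta_set G J = theta_graph G"

end

theory Submission imports Defs begin

text \<open>
  Let \<open>\<mu>\<close> be optimal with usage \<open>\<eta>\<close>. By first-order optimality every tree charged by \<open>\<mu>\<close> has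
  minimum \<open>\<eta>\<close>-weight, so by Kruskal's exchange it meets the set \<open>K\<close> where \<open>\<eta>\<close> is maximal in as few
  edges as possible. Averaging \<open>|T \<inter> K|\<close> over \<open>\<mu>\<close> gives \<open>max \<eta> = \<theta>(K) \<le> \<theta>(G)\<close>, and averaging
  \<open>|T \<inter> J|\<close> then shows that for critical \<open>J\<close> every charged tree meets \<open>J\<close> in \<open>M(J)\<close> edges. Such a
  tree restricts to a spanning tree of each \<open>G\<^sub>i\<close>, and its part in \<open>G\<^sub>i\<close> can be exchanged for any other
  spanning tree of \<open>G\<^sub>i\<close>. Hence the marginal of \<open>\<mu>\<close> on \<open>G\<^sub>i\<close> is optimal for \<open>G\<^sub>i\<close>, and optimal usages
  are unique.
\<close>

subsection \<open>Connectivity and component counting\<close>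

text \<open>Connectivity lives on the whole vertex type and depends only on the end map and the edge
  set, so edge sets of \<open>G\<close> and of its induced subgraphs can be compared directly. When
  all edges of \<open>A\<close> have their ends in \<open>V\<close>,
  \<open>V // conn_rel d A\<close> is the set of components of \<open>(V, A)\<close>.\<close>

definition conn_rel :: "('e \<Rightarrow> 'v set) \<Rightarrow> 'e set \<Rightarrow> ('v \<times> 'v) set" where
  "conn_rel d A = {(u, v). \<exists>e\<in>A. d e = {u, v}}\<^sup>*"

lemma conn_rel_refl [simp]: "(u, u) \<in> conn_rel d A"
  by (simp add: conn_rel_def)

lemma conn_rel_trans: "(u, v) \<in> conn_rel d A \<Longrightarrow> (v, w) \<in> conn_rel d A \<Longrightarrow> (u, w) \<in> conn_rel d A"
  unfolding conn_rel_def by (rule rtrancl_trans)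

lemma conn_rel_sym: "(u, v) \<in> conn_rel d A \<Longrightarrow> (v, u) \<in> conn_rel d A"
proof -
  have "sym {(u, v). \<exists>e\<in>A. d e = {u, v}}"
    by (auto simp: sym_def insert_commute)
  then show "(u, v) \<in> conn_rel d A \<Longrightarrow> (v, u) \<in> conn_rel d A"
    unfolding conn_rel_def by (meson sym_rtrancl symD)
qed

lemma conn_rel_mono: "A \<subseteq> B \<Longrightarrow> conn_rel d A \<subseteq> conn_rel d B"
  unfolding conn_rel_def by (rule rtrancl_mono) auto

lemma conn_rel_edge: "e \<in> A \<Longrightarrow> d e = {u, v} \<Longrightarrow> (u, v) \<in> conn_rel d A"
  unfolding conn_rel_def by (rule r_into_rtrancl) auto

lemma conn_rel_subsetI:
  assumes "\<And>e u v. e \<in> A \<Longrightarrow> d e = {u, v} \<Longrightarrow> (u, v) \<in> conn_rel d B"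
  shows "conn_rel d A \<subseteq> conn_rel d B"
  using assms unfolding conn_rel_def by (intro rtrancl_subset_rtrancl) auto

text \<open>A walk can be shortened until it crosses the new edge at most once; the last two
  disjuncts are the two directions of crossing.\<close>

lemma conn_rel_insert_iff:
  assumes "d e = {u, v}"
  shows "(x, y) \<in> conn_rel d (insert e A) \<longleftrightarrow> (x, y) \<in> conn_rel d A \<or>
    (x, u) \<in> conn_rel d A \<and> (v, y) \<in> conn_rel d A \<or> (x, v) \<in> conn_rel d A \<and> (u, y) \<in> conn_rel d A"
proof -
  have "{(x, y). \<exists>e\<in>insert e A. d e = {x, y}} =
      insert (u, v) (insert (v, u) {(x, y). \<exists>e\<in>A. d e = {x, y}})"
    using assms by (auto simp: doubleton_eq_iff)
  then have "(x, y) \<in> conn_rel d (insert e A) \<longleftrightarrow>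
      (x, y) \<in> (insert (u, v) (insert (v, u) {(x, y). \<exists>e\<in>A. d e = {x, y}}))\<^sup>*"
    by (simp add: conn_rel_def)
  then show ?thesis
    unfolding rtrancl_insert conn_rel_def[symmetric]
    by (auto intro: conn_rel_trans[of x u d A y] conn_rel_trans[of x v d A y])
qed

lemma conn_rel_insert_redundant:
  assumes "d e = {u, v}" "(u, v) \<in> conn_rel d A"
  shows "conn_rel d (insert e A) = conn_rel d A"
proof (rule antisym)
  show "conn_rel d (insert e A) \<subseteq> conn_rel d A"
  proof (rule conn_rel_subsetI)
    fix f x y assume f: "f \<in> insert e A" "d f = {x, y}"
    show "(x, y) \<in> conn_rel d A"
    proof (cases "f = e")
      case True
      then have "{x, y} = {u, v}" using f assms(1) by simp
      then show ?thesis using assms(2) conn_rel_sym by (auto simp: doubleton_eq_iff)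
    next
      case False
      then show ?thesis using f by (intro conn_rel_edge[of f]) auto
    qed
  qed
qed (rule conn_rel_mono, auto)

lemma conn_rel_Image_eq_iff:
  "conn_rel d A `` {x} = conn_rel d A `` {y} \<longleftrightarrow> (x, y) \<in> conn_rel d A"
proof
  assume "conn_rel d A `` {x} = conn_rel d A `` {y}"
  then show "(x, y) \<in> conn_rel d A" by (metis Image_singleton_iff conn_rel_refl)
next
  assume "(x, y) \<in> conn_rel d A"
  then show "conn_rel d A `` {x} = conn_rel d A `` {y}"
    by (auto intro: conn_rel_trans[of x y] conn_rel_trans[of y x] conn_rel_sym[of x y])
qed

text \<open>The new edge fuses the classes of \<open>u\<close> and \<open>v\<close> into one and
  leaves every other class alone.\<close>

lemma card_quotient_conn_rel_insert:
  fixes d :: "'e \<Rightarrow> 'v set"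
  assumes V: "finite V" "u \<in> V" "v \<in> V" and e: "d e = {u, v}" and nuv: "(u, v) \<notin> conn_rel d A"
  shows "card (V // conn_rel d A) = Suc (card (V // conn_rel d (insert e A)))"
proof -
  let ?r = "conn_rel d A" and ?s = "conn_rel d (insert e A)"
  define W where "W = V - ?r `` {u} - ?r `` {v}"
  have Im: "?s `` {x} = ?r `` {x} \<union> (if (x, u) \<in> ?r then ?r `` {v} else {}) \<union> (if (x, v) \<in> ?r then ?r `` {u} else {})"
    for x by (auto simp: conn_rel_insert_iff[of d e u v, OF e])
  have s_out: "?s `` {x} = ?r `` {x}" if "x \<in> W" for x
  proof -
    have "(x, u) \<notin> ?r" "(x, v) \<notin> ?r"
      using that conn_rel_sym[of x u d A] conn_rel_sym[of x v d A] by (auto simp: W_def)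
    then show ?thesis unfolding Im by simp
  qed
  have s_in: "?s `` {x} = ?r `` {u} \<union> ?r `` {v}" if "(u, x) \<in> ?r \<or> (v, x) \<in> ?r" for x
    using that
  proof
    assume ux: "(u, x) \<in> ?r"
    then have "?r `` {x} = ?r `` {u}" "(x, u) \<in> ?r"
      by (simp_all add: conn_rel_Image_eq_iff conn_rel_sym)
    then show ?thesis unfolding Im by auto
  next
    assume vx: "(v, x) \<in> ?r"
    then have "?r `` {x} = ?r `` {v}" "(x, v) \<in> ?r"
      by (simp_all add: conn_rel_Image_eq_iff conn_rel_sym)
    then show ?thesis unfolding Im by auto
  qed
  \<comment> \<open>Naming \<open>u\<close> and \<open>v\<close> explicitly makes the first two
    pieces visibly nonempty, so each contributes exactly one class.\<close>
  have Vu: "V = insert u (V \<inter> ?r `` {u}) \<union> insert v (V \<inter> ?r `` {v}) \<union> W"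
    using V by (auto simp: W_def)
  have q: "B // r = (\<lambda>x. r `` {x}) ` B" for B :: "'v set" and r
    by (auto simp: quotient_def)
  have "(\<lambda>x. ?r `` {x}) ` insert u (V \<inter> ?r `` {u}) = {?r `` {u}}"
    "(\<lambda>x. ?r `` {x}) ` insert v (V \<inter> ?r `` {v}) = {?r `` {v}}"
    using conn_rel_Image_eq_iff[of d A u] conn_rel_Image_eq_iff[of d A v] by blast+
  then have "V // ?r = insert (?r `` {u}) (insert (?r `` {v}) (W // ?r))"
    unfolding q by (subst Vu) (simp only: image_Un, simp add: insert_commute)
  moreover have "?r `` {u} \<noteq> ?r `` {v}"
    using nuv by (simp add: conn_rel_Image_eq_iff)
  moreover have "?r `` {u} \<notin> W // ?r" "?r `` {v} \<notin> W // ?r"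
  proof -
    have "?r `` {u} \<noteq> ?r `` {x} \<and> ?r `` {v} \<noteq> ?r `` {x}" if "x \<in> W" for x
      using that unfolding conn_rel_Image_eq_iff by (simp add: W_def)
    then show "?r `` {u} \<notin> W // ?r" "?r `` {v} \<notin> W // ?r"
      unfolding q by blast+
  qed
  moreover have "finite (W // ?r)"
    using V(1) unfolding W_def q by simp
  ultimately have 1: "card (V // ?r) = Suc (Suc (card (W // ?r)))"
    by simp
  have "(\<lambda>x. ?s `` {x}) ` insert u (V \<inter> ?r `` {u}) = {?r `` {u} \<union> ?r `` {v}}"
    "(\<lambda>x. ?s `` {x}) ` insert v (V \<inter> ?r `` {v}) = {?r `` {u} \<union> ?r `` {v}}"
  proof -
    have "?s `` {x} = ?r `` {u} \<union> ?r `` {v}" if "x \<in> insert u (?r `` {u}) \<union> insert v (?r `` {v})" for x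
      using that by (intro s_in) auto
    then show "(\<lambda>x. ?s `` {x}) ` insert u (V \<inter> ?r `` {u}) = {?r `` {u} \<union> ?r `` {v}}"
      "(\<lambda>x. ?s `` {x}) ` insert v (V \<inter> ?r `` {v}) = {?r `` {u} \<union> ?r `` {v}}"
      by blast+
  qed
  moreover have "(\<lambda>x. ?s `` {x}) ` W = (\<lambda>x. ?r `` {x}) ` W"
    using s_out by (rule image_cong[OF refl])
  ultimately have "V // ?s = insert (?r `` {u} \<union> ?r `` {v}) (W // ?r)"
    unfolding q by (subst Vu) (simp only: image_Un, simp add: insert_commute)
  moreover have "?r `` {u} \<union> ?r `` {v} \<notin> W // ?r"
  proof
    assume "?r `` {u} \<union> ?r `` {v} \<in> W // ?r"
    then obtain x where x: "x \<in> W" "?r `` {u} \<union> ?r `` {v} = ?r `` {x}"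
      by (auto simp: quotient_def)
    have "u \<in> ?r `` {x}"
      unfolding x(2)[symmetric] by simp
    then have "(x, u) \<in> ?r"
      by simp
    then show False using x(1) conn_rel_sym[of x u d A] by (auto simp: W_def)
  qed
  ultimately show ?thesis
    using 1 \<open>finite (W // ?r)\<close> by simp
qed

lemma card_quotient_conn_rel_empty: "card (V // conn_rel d {}) = card V"
proof -
  have "conn_rel d {} = Id" by (simp add: conn_rel_def)
  then have "V // conn_rel d {} = (\<lambda>x. {x}) ` V" by (auto simp: quotient_def)
  then show ?thesis by (simp add: card_image)
qed

lemma card_quotient_conn_rel_connected:
  assumes "V \<noteq> {}" "V \<times> V \<subseteq> conn_rel d A"
  shows "card (V // conn_rel d A) = 1"
proof -
  obtain x where x: "x \<in> V" using assms by auto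
  have "conn_rel d A `` {y} = conn_rel d A `` {x}" if "y \<in> V" for y
    unfolding conn_rel_Image_eq_iff using that x assms(2) by blast
  then have "V // conn_rel d A = {conn_rel d A `` {x}}" using x unfolding quotient_def by blast
  then show ?thesis by simp
qed

text \<open>Saturating a class of the finer relation under the coarser one maps the finer classes
  onto the coarser ones.\<close>

lemma card_quotient_conn_rel_antimono:
  assumes "finite V" "conn_rel d A \<subseteq> conn_rel d B"
  shows "card (V // conn_rel d B) \<le> card (V // conn_rel d A)"
proof -
  have "V // conn_rel d B \<subseteq> (\<lambda>X. conn_rel d B `` X) ` (V // conn_rel d A)"
  proof
    fix X assume "X \<in> V // conn_rel d B"
    then obtain x where x: "x \<in> V" "X = conn_rel d B `` {x}" by (auto simp: quotient_def)
    have "conn_rel d B `` (conn_rel d A `` {x}) = X"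
    proof (intro set_eqI iffI)
      fix z assume "z \<in> conn_rel d B `` (conn_rel d A `` {x})"
      then obtain y where "(x, y) \<in> conn_rel d A" "(y, z) \<in> conn_rel d B" by auto
      with assms(2) have "(x, z) \<in> conn_rel d B" by (intro conn_rel_trans[of x y d B z]) auto
      then show "z \<in> X" unfolding x by simp
    next
      fix z assume "z \<in> X"
      then show "z \<in> conn_rel d B `` (conn_rel d A `` {x})" unfolding x by auto
    qed
    then show "X \<in> (\<lambda>X. conn_rel d B `` X) ` (V // conn_rel d A)"
      by (intro rev_image_eqI[OF quotientI[OF x(1), of "conn_rel d A"]]) simp
  qed
  moreover have "finite (V // conn_rel d A)" using assms(1) by (auto simp: quotient_def)
  ultimately show ?thesis by (rule surj_card_le[rotated])
qed

section \<open>Simple paths, cycles and bridges\<close>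

text \<open>Supplies the path that an edge closes to a cycle. The induction prepends a vertex; if
  that vertex already occurs at position \<open>k\<close>, the old path is cut to start there
  instead.\<close>

lemma conn_rel_simple_path:
  assumes "(u, v) \<in> conn_rel d A"
  shows "\<exists>vs es. length vs = Suc (length es) \<and> distinct vs \<and> set es \<subseteq> A \<and> hd vs = u \<and> last vs = v \<and>
    (\<forall>i<length es. d (es ! i) = {vs ! i, vs ! Suc i})"
  using assms unfolding conn_rel_def
proof (induction rule: converse_rtrancl_induct)
  case base
  show ?case by (intro exI[of _ "[v]"] exI[of _ "[]"]) simp
next
  case (step u w)
  then obtain f where f: "f \<in> A" "d f = {u, w}" by auto
  from step obtain vs es where p: "length vs = Suc (length es)" "distinct vs" "set es \<subseteq> A"
    "hd vs = w" "last vs = v" "\<forall>i<length es. d (es ! i) = {vs ! i, vs ! Suc i}" by auto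
  have vs: "vs \<noteq> []" "vs ! 0 = w" using p(1,4) by (cases vs; auto)+
  show ?case
  proof (cases "u \<in> set vs")
    case False
    have "d ((f # es) ! i) = {(u # vs) ! i, (u # vs) ! Suc i}" if "i < length (f # es)" for i
      using that f p(6) vs by (cases i) auto
    moreover have "length (u # vs) = Suc (length (f # es))" "distinct (u # vs)" "set (f # es) \<subseteq> A"
        "hd (u # vs) = u" "last (u # vs) = v"
      using p(1,2,3,5) f(1) False vs(1) by simp_all
    ultimately show ?thesis by blast
  next
    case True
    then obtain k where k: "k < length vs" "vs ! k = u" by (auto simp: in_set_conv_nth)
    have "set (drop k es) \<subseteq> A" using p(3) set_drop_subset[of k es] by simp
    moreover have "d (drop k es ! i) = {drop k vs ! i, drop k vs ! Suc i}" if "i < length (drop k es)" for i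
      using that p(1,6) by (simp add: add.commute)
    moreover have "hd (drop k vs) = u" "last (drop k vs) = v" "length (drop k vs) = Suc (length (drop k es))"
      using k p(1,5) by (simp_all add: hd_drop_conv_nth)
    moreover have "distinct (drop k vs)" using p(2) by simp
    ultimately show ?thesis by blast
  qed
qed

text \<open>Trades cycles given as lists for connectivity: an edge lies on a cycle exactly when its
  ends stay joined after its removal.\<close>

lemma acyclic_mgraph_iff_bridges:
  assumes "\<And>e. e \<in> edges G \<Longrightarrow> card (ends G e) = 2"
  shows "acyclic_mgraph G \<longleftrightarrow>
    (\<forall>e\<in>edges G. \<forall>u v. ends G e = {u, v} \<longrightarrow> (u, v) \<notin> conn_rel (ends G) (edges G - {e}))"
proof (intro iffI ballI allI impI notI)
  fix e u v
  assume ac: "acyclic_mgraph G" and e: "e \<in> edges G" "ends G e = {u, v}"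
    and uv: "(u, v) \<in> conn_rel (ends G) (edges G - {e})"
  from conn_rel_simple_path[OF uv] obtain vs es where
    p: "length vs = Suc (length es)" "distinct vs" "set es \<subseteq> edges G - {e}" "hd vs = u" "last vs = v"
      "\<forall>i<length es. ends G (es ! i) = {vs ! i, vs ! Suc i}" by blast
  have "vs \<noteq> []" using p(1) by auto
  then have nth: "vs ! 0 = u" "vs ! length es = v"
    using p(1,4,5) by (auto simp: hd_conv_nth last_conv_nth)
  \<comment> \<open>On a simple path the end set \<open>{vs ! i, vs ! Suc i}\<close> determines
    \<open>i\<close>, so no edge repeats.\<close>
  have "distinct es"
  proof (rule distinct_conv_nth[THEN iffD2], intro allI impI)
    fix i j assume ij: "i < length es" "j < length es" "i \<noteq> j"
    show "es ! i \<noteq> es ! j"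
    proof
      assume "es ! i = es ! j"
      then have "{vs ! i, vs ! Suc i} = {vs ! j, vs ! Suc j}" using p(6) ij by metis
      then show False using ij p(1,2) by (auto simp: doubleton_eq_iff nth_eq_iff_index_eq)
    qed
  qed
  \<comment> \<open>Appending \<open>e\<close> makes the edge list as long as \<open>vs\<close>; at
    the last index the successor wraps to 0, and \<open>e\<close> leads from \<open>v\<close> back
    to \<open>u\<close>.\<close>
  moreover have "ends G ((es @ [e]) ! i) = {vs ! i, vs ! (Suc i mod length (es @ [e]))}"
    if "i < length (es @ [e])" for i
  proof (cases "i = length es")
    case False
    then have "i < length es" "Suc i mod length (es @ [e]) = Suc i"
      using that by (auto intro: mod_less)
    then show ?thesis using p(6) by (simp add: nth_append)
  qed (simp add: e nth insert_commute)
  ultimately have "is_cycle G vs (es @ [e])"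
    unfolding is_cycle_def using p(1,2,3) e by auto
  with ac show False by (auto simp: acyclic_mgraph_def)
next
  assume br: "\<forall>e\<in>edges G. \<forall>u v. ends G e = {u, v} \<longrightarrow> (u, v) \<notin> conn_rel (ends G) (edges G - {e})"
  show "acyclic_mgraph G" unfolding acyclic_mgraph_def
  proof (intro notI, elim exE)
    fix vs es assume c: "is_cycle G vs es"
    define n where "n = length es - 1"
    have n: "length es = Suc n" using c by (auto simp: is_cycle_def n_def)
    let ?e = "es ! n"
    have en: "ends G (es ! i) = {vs ! i, vs ! (Suc i mod Suc n)}" if "i < Suc n" for i
      using that c n by (auto simp: is_cycle_def)
    \<comment> \<open>Walking along the other edges of the cycle joins the ends of its last edge
      \<open>?e\<close>, so \<open>?e\<close> is not a bridge.\<close>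
    have "(vs ! 0, vs ! i) \<in> conn_rel (ends G) (edges G - {?e})" if "i \<le> n" for i
      using that
    proof (induction i)
      case (Suc i)
      have "es ! i \<in> edges G - {?e}"
        using c n Suc.prems by (auto simp: is_cycle_def nth_eq_iff_index_eq)
      moreover have "ends G (es ! i) = {vs ! i, vs ! Suc i}" using en[of i] Suc.prems by simp
      ultimately have "(vs ! i, vs ! Suc i) \<in> conn_rel (ends G) (edges G - {?e})"
        by (rule conn_rel_edge)
      moreover have "(vs ! 0, vs ! i) \<in> conn_rel (ends G) (edges G - {?e})"
        using Suc by simp
      ultimately show ?case by (rule conn_rel_trans[rotated])
    qed simp
    from conn_rel_sym[OF this[OF order_refl]] have "(vs ! n, vs ! 0) \<in> conn_rel (ends G) (edges G - {?e})" .
    moreover have "?e \<in> edges G" using c n by (auto simp: is_cycle_def)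
    moreover have "ends G ?e = {vs ! n, vs ! 0}" using en[of n] by simp
    ultimately show False using br by blast
  qed
qed

section \<open>Counting edges against components\<close>

text \<open>Without edges there are \<open>card V\<close> components, and each added edge lowers the
  number by at most one.\<close>

lemma card_le_card_add_quotient_conn_rel:
  assumes "finite V" "finite A" "\<And>e. e \<in> A \<Longrightarrow> d e \<subseteq> V \<and> card (d e) = 2"
  shows "card V \<le> card A + card (V // conn_rel d A)"
  using assms(2,3)
proof (induction A rule: finite_induct)
  case empty
  then show ?case by (simp add: card_quotient_conn_rel_empty)
next
  case (insert e A)
  obtain u v where e: "d e = {u, v}" using insert.prems[of e] by (auto simp: card_2_iff)
  have uv: "u \<in> V" "v \<in> V" using e insert.prems[of e] by auto
  have IH: "card V \<le> card A + card (V // conn_rel d A)" using insert by auto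
  show ?case
  proof (cases "(u, v) \<in> conn_rel d A")
    case True
    then show ?thesis using IH insert.hyps conn_rel_insert_redundant[of d e u v A, OF e] by simp
  next
    case False
    then show ?thesis
      using IH insert.hyps card_quotient_conn_rel_insert[of V u v d e A, OF assms(1) uv e False] by simp
  qed
qed

text \<open>In a forest each added edge joins two different components, so the count drops by
  exactly one every time.\<close>

lemma card_add_quotient_conn_rel_forest:
  assumes "finite V" "finite A" "\<And>e. e \<in> A \<Longrightarrow> d e \<subseteq> V \<and> card (d e) = 2"
    and bridges: "\<And>e u v. e \<in> A \<Longrightarrow> d e = {u, v} \<Longrightarrow> (u, v) \<notin> conn_rel d (A - {e})"
  shows "card A + card (V // conn_rel d A) = card V"
  using assms(2,3,4)
proof (induction A rule: finite_induct)
  case empty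
  then show ?case by (simp add: card_quotient_conn_rel_empty)
next
  case (insert e A)
  obtain u v where e: "d e = {u, v}" using insert.prems(1)[of e] by (auto simp: card_2_iff)
  have uv: "u \<in> V" "v \<in> V" using e insert.prems(1)[of e] by auto
  have "(x, y) \<notin> conn_rel d (A - {f})" if "f \<in> A" "d f = {x, y}" for f x y
    using insert.prems(2)[of f x y] that conn_rel_mono[of "A - {f}" "insert e A - {f}" d] by auto
  then have IH: "card A + card (V // conn_rel d A) = card V" using insert by auto
  have "(u, v) \<notin> conn_rel d A" using insert.prems(2)[of e u v] e insert.hyps by simp
  then show ?case
    using IH insert.hyps card_quotient_conn_rel_insert[of V u v d e A, OF assms(1) uv e] by simp
qed

subsection \<open>Spanning trees\<close>

lemma connected_mgraph_iff_conn_rel: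
  "connected_mgraph (G\<lparr>edges := A\<rparr>) \<longleftrightarrow> verts G \<noteq> {} \<and> verts G \<times> verts G \<subseteq> conn_rel (ends G) A"
  by (auto simp: connected_mgraph_def reach_rel_def adj_rel_def conn_rel_def)

lemma finite_mgraphD:
  assumes "finite_mgraph G"
  shows "finite (verts G)" "finite (edges G)"
    "e \<in> edges G \<Longrightarrow> ends G e \<subseteq> verts G" "e \<in> edges G \<Longrightarrow> card (ends G e) = 2"
  using assms by (auto simp: finite_mgraph_def)

lemma spanning_trees_iff_bridges:
  assumes "finite_mgraph G"
  shows "T \<in> spanning_trees G \<longleftrightarrow> T \<subseteq> edges G \<and> verts G \<noteq> {} \<and>
    verts G \<times> verts G \<subseteq> conn_rel (ends G) T \<and>
    (\<forall>e\<in>T. \<forall>u v. ends G e = {u, v} \<longrightarrow> (u, v) \<notin> conn_rel (ends G) (T - {e}))"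
proof -
  have "acyclic_mgraph (G\<lparr>edges := T\<rparr>) \<longleftrightarrow>
      (\<forall>e\<in>T. \<forall>u v. ends G e = {u, v} \<longrightarrow> (u, v) \<notin> conn_rel (ends G) (T - {e}))" if "T \<subseteq> edges G"
    using acyclic_mgraph_iff_bridges[of "G\<lparr>edges := T\<rparr>"] finite_mgraphD[OF assms] that by auto
  then show ?thesis
    unfolding spanning_trees_def connected_mgraph_iff_conn_rel by blast
qed

text \<open>With this form exchange arguments need not inspect cycles: only connectivity and the
  number of edges have to be preserved.\<close>

lemma spanning_trees_iff_card:
  assumes G: "finite_mgraph G"
  shows "T \<in> spanning_trees G \<longleftrightarrow> T \<subseteq> edges G \<and> verts G \<noteq> {} \<and>
    verts G \<times> verts G \<subseteq> conn_rel (ends G) T \<and> card T + 1 = card (verts G)"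
proof -
  let ?d = "ends G" and ?V = "verts G"
  note G' = finite_mgraphD[OF G]
  have "(\<forall>e\<in>T. \<forall>u v. ?d e = {u, v} \<longrightarrow> (u, v) \<notin> conn_rel ?d (T - {e})) \<longleftrightarrow> card T + 1 = card ?V"
    if T: "T \<subseteq> edges G" and V: "?V \<noteq> {}" "?V \<times> ?V \<subseteq> conn_rel ?d T"
  proof
    have fT: "finite T" using T G'(2) by (rule finite_subset)
    have d: "?d e \<subseteq> ?V \<and> card (?d e) = 2" if "e \<in> T" for e
      using that G'(3,4) T by auto
    {
      assume "\<forall>e\<in>T. \<forall>u v. ?d e = {u, v} \<longrightarrow> (u, v) \<notin> conn_rel ?d (T - {e})"
      then have "card T + card (?V // conn_rel ?d T) = card ?V"
        by (intro card_add_quotient_conn_rel_forest[OF G'(1) fT d]) auto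
      then show "card T + 1 = card ?V"
        using card_quotient_conn_rel_connected[OF V] by simp
    next
      assume c: "card T + 1 = card ?V"
      show "\<forall>e\<in>T. \<forall>u v. ?d e = {u, v} \<longrightarrow> (u, v) \<notin> conn_rel ?d (T - {e})"
      proof (intro ballI allI impI notI)
        fix e u v assume e: "e \<in> T" "?d e = {u, v}" "(u, v) \<in> conn_rel ?d (T - {e})"
        then have "conn_rel ?d (T - {e}) = conn_rel ?d T"
          using conn_rel_insert_redundant[of ?d e u v "T - {e}", OF e(2,3)] by (simp add: insert_absorb)
        then have "card (?V // conn_rel ?d (T - {e})) = 1"
          using card_quotient_conn_rel_connected[OF V] by simp
        \<comment> \<open>Deleting a non-bridge would leave one component, although
          \<open>card ?V - 2\<close> edges leave at least two.\<close>
        moreover have "card ?V \<le> card (T - {e}) + card (?V // conn_rel ?d (T - {e}))"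
          using fT d by (intro card_le_card_add_quotient_conn_rel[OF G'(1)]) auto
        moreover have "Suc (card (T - {e})) = card T"
          using fT e(1) by (rule card_Suc_Diff1)
        ultimately show False using c by simp
      qed
    }
  qed
  then show ?thesis
    unfolding spanning_trees_iff_bridges[OF G] by blast
qed

lemma finite_spanning_trees: "finite_mgraph G \<Longrightarrow> finite (spanning_trees G)"
  by (rule finite_subset[of _ "Pow (edges G)"]) (auto simp: spanning_trees_def finite_mgraph_def)

text \<open>In a connecting edge set of least cardinality every edge is a bridge.\<close>

lemma spanning_trees_nonempty:
  assumes G: "finite_mgraph G" and conn: "connected_mgraph G"
  shows "spanning_trees G \<noteq> {}"
proof -
  let ?d = "ends G" and ?V = "verts G"
  let ?P = "\<lambda>A. A \<subseteq> edges G \<and> ?V \<times> ?V \<subseteq> conn_rel ?d A"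
  have V: "?V \<noteq> {}" "?P (edges G)"
    using conn connected_mgraph_iff_conn_rel[where G = G and A = "edges G"] by auto
  then obtain T where T: "?P T" and min: "\<And>A. ?P A \<Longrightarrow> card T \<le> card A"
    using ex_has_least_nat[of ?P "edges G" card] by blast
  have "finite T" using T finite_mgraphD(2)[OF G] by (auto intro: finite_subset)
  have "(u, v) \<notin> conn_rel ?d (T - {e})" if e: "e \<in> T" "?d e = {u, v}" for e u v
  proof
    assume "(u, v) \<in> conn_rel ?d (T - {e})"
    then have "conn_rel ?d (T - {e}) = conn_rel ?d T"
      using conn_rel_insert_redundant[of ?d e u v "T - {e}", OF e(2)] e(1) by (simp add: insert_absorb)
    then have "?P (T - {e})" using T by auto
    from min[OF this] show False using card_Diff1_less[OF \<open>finite T\<close> e(1)] by simp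
  qed
  then have "T \<in> spanning_trees G"
    using T V(1) by (auto simp: spanning_trees_iff_bridges[OF G])
  then show ?thesis by auto
qed

section \<open>Exchange and augmentation\<close>

text \<open>The set \<open>A\<close> is protected: the edge given up for \<open>e\<close> is taken
  outside it. Such an edge exists because the tree joins \<open>u\<close> and \<open>v\<close> while
  \<open>A\<close> does not.\<close>

lemma spanning_tree_exchange:
  assumes G: "finite_mgraph G" and T: "T \<in> spanning_trees G" and e: "e \<in> edges G" "ends G e = {u, v}"
    and A: "A \<subseteq> T" "(u, v) \<notin> conn_rel (ends G) A"
  obtains f where "f \<in> T - A" "insert e (T - {f}) \<in> spanning_trees G" "e \<notin> T - {f}"
proof -
  let ?d = "ends G" and ?V = "verts G"
  note T' = T[unfolded spanning_trees_iff_card[OF G]]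
  have finT: "finite T" using T' finite_mgraphD(2)[OF G] by (auto intro: finite_subset)
  have uvV: "(u, v) \<in> ?V \<times> ?V" using finite_mgraphD(3)[OF G e(1)] e(2) by auto
  show thesis
  proof (cases "e \<in> T")
    case True
    \<comment> \<open>Here \<open>f = e\<close> and the tree stays the same; \<open>e\<close> is
      outside \<open>A\<close> because \<open>A\<close> does not join its ends.\<close>
    have "e \<notin> A" using A(2) conn_rel_edge[of e A ?d u v] e(2) by blast
    then show thesis using True T that[of e] by (auto simp: insert_absorb)
  next
    case False
    let ?P = "\<lambda>S. A \<subseteq> S \<and> S \<subseteq> T \<and> (u, v) \<in> conn_rel ?d S"
    have "?P T" using A(1) T' uvV by auto
    \<comment> \<open>\<open>S\<close> is a smallest set between \<open>A\<close> and
      \<open>T\<close> that joins \<open>u\<close> and \<open>v\<close>; any edge of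
      \<open>S\<close> outside \<open>A\<close> is then indispensable for this.\<close>
    then obtain S where S: "?P S" and min: "\<And>B. ?P B \<Longrightarrow> card S \<le> card B"
      using ex_has_least_nat[of ?P T card] by blast
    have "S \<noteq> A" using S A(2) by auto
    then obtain f where f: "f \<in> S" "f \<notin> A" using S by auto
    have "finite S" using S finT by (auto intro: finite_subset)
    then have nuv: "(u, v) \<notin> conn_rel ?d (S - {f})"
      using min[of "S - {f}"] S f card_Diff1_less[of S f] by auto
    have fE: "f \<in> edges G" using f S T' by auto
    obtain x y where xy: "?d f = {x, y}"
      using finite_mgraphD(4)[OF G fE] by (auto simp: card_2_iff)
    have S': "insert f (S - {f}) = S" using f(1) by auto
    have "(u, v) \<in> conn_rel ?d (insert f (S - {f}))" using S S' by simp
    \<comment> \<open>As \<open>f\<close> is needed to join \<open>u\<close> to \<open>v\<close> in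
      \<open>S\<close>, one end of \<open>f\<close> stays joined to \<open>u\<close> and the other
      to \<open>v\<close>; hence \<open>e\<close> reconnects the ends of \<open>f\<close>.\<close>
    then have "(u, x) \<in> conn_rel ?d (S - {f}) \<and> (y, v) \<in> conn_rel ?d (S - {f}) \<or>
        (u, y) \<in> conn_rel ?d (S - {f}) \<and> (x, v) \<in> conn_rel ?d (S - {f})"
      unfolding conn_rel_insert_iff[of ?d f x y, OF xy] using nuv by blast
    then have "(x, y) \<in> conn_rel ?d (insert e (S - {f}))"
      unfolding conn_rel_insert_iff[of ?d e u v, OF e(2)] using conn_rel_sym[of _ _ ?d "S - {f}"] by blast
    moreover have "conn_rel ?d (insert e (S - {f})) \<subseteq> conn_rel ?d (insert e (T - {f}))"
      using S by (intro conn_rel_mono) auto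
    ultimately have xy': "(x, y) \<in> conn_rel ?d (insert e (T - {f}))" by blast
    have fT: "f \<in> T" using f S by auto
    have "conn_rel ?d T \<subseteq> conn_rel ?d (insert f (insert e (T - {f})))"
      by (intro conn_rel_mono) auto
    also have "\<dots> = conn_rel ?d (insert e (T - {f}))"
      by (rule conn_rel_insert_redundant[of ?d f x y, OF xy xy'])
    finally have "?V \<times> ?V \<subseteq> conn_rel ?d (insert e (T - {f}))" using T' by blast
    moreover have "card (insert e (T - {f})) = card T"
      using finT False card_Suc_Diff1[OF finT fT] by simp
    ultimately have "insert e (T - {f}) \<in> spanning_trees G"
      unfolding spanning_trees_iff_card[OF G] using T' e(1) by auto
    then show thesis using that[of f] f fT False by auto
  qed
qed

text \<open>Matroid augmentation by counting: the forest \<open>B\<close> leaves exactly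
  \<open>card V - card B\<close> components and \<open>A\<close> at least
  \<open>card V - card A\<close>, which is more. So \<open>A\<close> cannot join the ends of all
  edges of \<open>B\<close>.\<close>

lemma spanning_tree_augment:
  assumes G: "finite_mgraph G" and T: "T \<in> spanning_trees G" and A: "A \<subseteq> edges G" and B: "B \<subseteq> T"
    and less: "card A < card B"
  obtains e u v where "e \<in> B" "ends G e = {u, v}" "(u, v) \<notin> conn_rel (ends G) A"
proof (rule ccontr)
  assume "\<not> thesis"
  with that have "conn_rel (ends G) B \<subseteq> conn_rel (ends G) A"
    by (intro conn_rel_subsetI) blast
  then have "card (verts G // conn_rel (ends G) A) \<le> card (verts G // conn_rel (ends G) B)"
    by (intro card_quotient_conn_rel_antimono finite_mgraphD(1)[OF G])
  moreover have "card (verts G) \<le> card A + card (verts G // conn_rel (ends G) A)"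
    using A finite_mgraphD[OF G] by (intro card_le_card_add_quotient_conn_rel) (auto intro: finite_subset)
  moreover have "card B + card (verts G // conn_rel (ends G) B) = card (verts G)"
  proof (rule card_add_quotient_conn_rel_forest)
    have T': "T \<subseteq> edges G" using T by (simp add: spanning_trees_def)
    then show "finite B" using B finite_mgraphD(2)[OF G] by (auto intro: finite_subset)
    show "ends G e \<subseteq> verts G \<and> card (ends G e) = 2" if "e \<in> B" for e
      using that B T' finite_mgraphD(3,4)[OF G] by auto
    show "(u, v) \<notin> conn_rel (ends G) (B - {e})" if "e \<in> B" "ends G e = {u, v}" for e u v
      using that B T[unfolded spanning_trees_iff_bridges[OF G]] conn_rel_mono[of "B - {e}" "T - {e}" "ends G"]
      by blast
  qed (rule finite_mgraphD(1)[OF G])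
  ultimately show False using less by linarith
qed

section \<open>Trees of minimum weight and of minimum overlap\<close>

text \<open>If \<open>T\<close> had more heaviest edges than \<open>S\<close>, it would have fewer
  lighter ones, since all spanning trees have equal size. Augmentation then finds a lighter edge of
  \<open>S\<close> that can replace a heaviest edge of \<open>T\<close>.\<close>

lemma min_weight_spanning_tree_heaviest_edges:
  fixes w :: "'e \<Rightarrow> real"
  assumes G: "finite_mgraph G" and T: "T \<in> spanning_trees G"
    and min: "\<And>S. S \<in> spanning_trees G \<Longrightarrow> sum w T \<le> sum w S"
    and m: "\<And>e. e \<in> edges G \<Longrightarrow> w e \<le> m"
    and S: "S \<in> spanning_trees G"
  shows "card (T \<inter> {e \<in> edges G. w e = m}) \<le> card (S \<inter> {e \<in> edges G. w e = m})"
proof (rule ccontr)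
  let ?K = "{e \<in> edges G. w e = m}"
  assume more: "\<not> ?thesis"
  note T' = T[unfolded spanning_trees_iff_card[OF G]] and S' = S[unfolded spanning_trees_iff_card[OF G]]
  have fin: "finite T" "finite S" using T' S' finite_mgraphD(2)[OF G] by (auto intro: finite_subset)
  have "card (T - ?K) + card (T \<inter> ?K) = card T" "card (S - ?K) + card (S \<inter> ?K) = card S"
    using fin by (metis add.commute card_Int_Diff)+
  then have "card (T - ?K) < card (S - ?K)" using more T' S' by linarith
  then obtain e u v where e: "e \<in> S - ?K" "ends G e = {u, v}" "(u, v) \<notin> conn_rel (ends G) (T - ?K)"
    using spanning_tree_augment[OF G S, of "T - ?K" "S - ?K"] T' by blast
  have eE: "e \<in> edges G" using e(1) S' by blast
  \<comment> \<open>Protecting \<open>T - ?K\<close> forces the removed edge \<open>f\<close> to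
    have weight \<open>m\<close>.\<close>
  obtain f where f: "f \<in> T - (T - ?K)" "insert e (T - {f}) \<in> spanning_trees G" "e \<notin> T - {f}"
    using spanning_tree_exchange[OF G T eE e(2) _ e(3)] by blast
  have "sum w (insert e (T - {f})) = w e + sum w (T - {f})"
    using fin(1) f(3) by (intro sum.insert) auto
  moreover have "sum w T = w f + sum w (T - {f})"
    using fin(1) f(1) by (intro sum.remove) auto
  moreover have "w e < w f" using m[OF eE] e(1) eE f(1) by auto
  ultimately show False using min[OF f(2)] by simp
qed

text \<open>An edge outside \<open>J\<close> whose ends \<open>T - J\<close> leaves apart could be
  exchanged for an edge of \<open>T\<close> in \<open>J\<close>, which would lower the
  overlap.\<close>

lemma conn_rel_min_overlap_tree:
  assumes G: "finite_mgraph G" and T: "T \<in> spanning_trees G"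
    and min: "\<And>S. S \<in> spanning_trees G \<Longrightarrow> card (T \<inter> J) \<le> card (S \<inter> J)"
  shows "conn_rel (ends G) (T - J) = conn_rel (ends G) (edges G - J)"
proof
  note T' = T[unfolded spanning_trees_iff_card[OF G]]
  have fin: "finite T" using T' finite_mgraphD(2)[OF G] by (auto intro: finite_subset)
  show "conn_rel (ends G) (T - J) \<subseteq> conn_rel (ends G) (edges G - J)"
    using T' by (intro conn_rel_mono) auto
  show "conn_rel (ends G) (edges G - J) \<subseteq> conn_rel (ends G) (T - J)"
  proof (rule conn_rel_subsetI, rule ccontr)
    fix e u v assume e: "e \<in> edges G - J" "ends G e = {u, v}" "(u, v) \<notin> conn_rel (ends G) (T - J)"
    then obtain f where f: "f \<in> T - (T - J)" "insert e (T - {f}) \<in> spanning_trees G"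
      using spanning_tree_exchange[OF G T, of e u v "T - J"] by blast
    have "insert e (T - {f}) \<inter> J = (T \<inter> J) - {f}" using e(1) by auto
    then have "card (insert e (T - {f}) \<inter> J) < card (T \<inter> J)"
      using f(1) fin card_Diff1_less[of "T \<inter> J" f] by simp
    with min[OF f(2)] show False by simp
  qed
qed

section \<open>Restricting and replacing trees on one component\<close>

text \<open>A walk starting in a closed set never leaves it, so it uses only edges inside the
  set.\<close>

lemma conn_rel_class_closed:
  assumes "(x, y) \<in> conn_rel d A" "x \<in> C" and C: "\<And>u v. u \<in> C \<Longrightarrow> (u, v) \<in> conn_rel d A \<Longrightarrow> v \<in> C"
  shows "(x, y) \<in> conn_rel d {e \<in> A. d e \<subseteq> C} \<and> y \<in> C"
  using assms(1) unfolding conn_rel_def[of d A]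
proof (induction rule: rtrancl_induct)
  case base
  then show ?case using assms(2) by simp
next
  case (step y z)
  then obtain e where e: "e \<in> A" "d e = {y, z}" by auto
  then have "z \<in> C" using step C[of y z] conn_rel_edge[of e A d y z] by auto
  then have "(y, z) \<in> conn_rel d {e \<in> A. d e \<subseteq> C}"
    using e step by (intro conn_rel_edge[of e]) auto
  then show ?case using step \<open>z \<in> C\<close> conn_rel_trans[of x y d "{e \<in> A. d e \<subseteq> C}" z] by blast
qed

text \<open>Unlike \<open>reach_rel\<close>, \<open>conn_rel\<close> is not confined to
  \<open>verts G\<close>; the closure property rests on edges having their ends in
  \<open>verts G\<close>.\<close>

lemma component_vertsD:
  assumes "U \<in> component_verts (G\<lparr>edges := A\<rparr>)"
  shows "U \<noteq> {}" "U \<subseteq> verts G" "U \<times> U \<subseteq> conn_rel (ends G) A"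
    "finite_mgraph G \<Longrightarrow> A \<subseteq> edges G \<Longrightarrow> u \<in> U \<Longrightarrow> (u, v) \<in> conn_rel (ends G) A \<Longrightarrow> v \<in> U"
proof -
  let ?R = "conn_rel (ends G) A"
  have "reach_rel (G\<lparr>edges := A\<rparr>) = verts G \<times> verts G \<inter> ?R"
    by (auto simp: reach_rel_def adj_rel_def conn_rel_def)
  then obtain x where x: "x \<in> verts G" "U = {v \<in> verts G. (x, v) \<in> ?R}"
    using assms unfolding component_verts_def quotient_def by auto
  show "U \<noteq> {}" "U \<subseteq> verts G" using x conn_rel_refl[of x "ends G" A] by blast+
  show "U \<times> U \<subseteq> ?R"
  proof clarify
    fix a b assume "a \<in> U" "b \<in> U"
    then have "(a, x) \<in> ?R" "(x, b) \<in> ?R" using x(2) conn_rel_sym[of x a] by auto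
    then show "(a, b) \<in> ?R" by (rule conn_rel_trans)
  qed
  assume G: "finite_mgraph G" and A: "A \<subseteq> edges G" and u: "u \<in> U" "(u, v) \<in> ?R"
  then have xv: "(x, v) \<in> ?R" using x(2) conn_rel_trans[of x u "ends G" A v] by auto
  have "v \<in> verts G"
  proof -
    have "b \<in> verts G" if "a \<in> verts G" "(a, b) \<in> ?R" for a b
      using that(2,1) unfolding conn_rel_def
    proof (induction rule: rtrancl_induct)
      case (step y z)
      then show ?case using finite_mgraphD(3)[OF G] A by blast
    qed
    then show ?thesis using xv x(1) by blast
  qed
  then show "v \<in> U" using xv x(2) by simp
qed

lemma finite_mgraph_induced:
  "finite_mgraph G \<Longrightarrow> U \<subseteq> verts G \<Longrightarrow> finite_mgraph (induced_mgraph G U)"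
  by (auto simp: finite_mgraph_def induced_mgraph_def intro: finite_subset)

text \<open>The edges of \<open>T - J\<close> inside \<open>U\<close> already connect
  \<open>U\<close>, because \<open>T - J\<close> has the same components as
  \<open>edges G - J\<close>. Bridges of \<open>T\<close> remain bridges in a subset.\<close>

lemma spanning_tree_restrict:
  assumes G: "finite_mgraph G" and T: "T \<in> spanning_trees G"
    and min: "\<And>S. S \<in> spanning_trees G \<Longrightarrow> card (T \<inter> J) \<le> card (S \<inter> J)"
    and U: "U \<in> component_verts (G\<lparr>edges := edges G - J\<rparr>)"
  shows "T \<inter> edges (induced_mgraph G U) \<in> spanning_trees (induced_mgraph G U)"
proof -
  let ?H = "induced_mgraph G U" and ?d = "ends G"
  let ?S = "T \<inter> edges ?H"
  have H: "verts ?H = U" "edges ?H = {e \<in> edges G. ?d e \<subseteq> U}" "ends ?H = ?d"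
    by (simp_all add: induced_mgraph_def)
  note T' = T[unfolded spanning_trees_iff_bridges[OF G]]
  note eq = conn_rel_min_overlap_tree[OF G T min]
  note Ud = component_vertsD[OF U]
  have fH: "finite_mgraph ?H" using G Ud(2) by (rule finite_mgraph_induced)
  have "(a, b) \<in> conn_rel ?d ?S" if "a \<in> U" "b \<in> U" for a b
  proof -
    have "(a, b) \<in> conn_rel ?d (T - J)" using that Ud(3) eq by auto
    then have "(a, b) \<in> conn_rel ?d {e \<in> T - J. ?d e \<subseteq> U}"
      using conn_rel_class_closed[of a b ?d "T - J" U] that(1) Ud(4)[OF G] eq by auto
    moreover have "conn_rel ?d {e \<in> T - J. ?d e \<subseteq> U} \<subseteq> conn_rel ?d ?S"
      using T' by (intro conn_rel_mono) (auto simp: H)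
    ultimately show ?thesis by blast
  qed
  moreover have "(u, v) \<notin> conn_rel ?d (?S - {e})" if "e \<in> ?S" "?d e = {u, v}" for e u v
    using that T' conn_rel_mono[of "?S - {e}" "T - {e}" ?d] by blast
  ultimately show ?thesis
    unfolding spanning_trees_iff_bridges[OF fH] H(1,3) using Ud(1) by auto
qed

text \<open>\<open>S\<close> reconnects the ends of every removed edge, and it has as many edges as
  the removed part because both are spanning trees of the induced subgraph.\<close>

lemma spanning_tree_replace:
  assumes G: "finite_mgraph G" and T: "T \<in> spanning_trees G" and U: "U \<subseteq> verts G"
    and TU: "T \<inter> edges (induced_mgraph G U) \<in> spanning_trees (induced_mgraph G U)"
    and S: "S \<in> spanning_trees (induced_mgraph G U)"
  shows "(T - edges (induced_mgraph G U)) \<union> S \<in> spanning_trees G"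
proof -
  let ?H = "induced_mgraph G U" and ?d = "ends G"
  let ?T = "(T - edges ?H) \<union> S"
  have H: "verts ?H = U" "edges ?H = {e \<in> edges G. ?d e \<subseteq> U}" "ends ?H = ?d"
    by (simp_all add: induced_mgraph_def)
  have fH: "finite_mgraph ?H" using G U by (rule finite_mgraph_induced)
  note T' = T[unfolded spanning_trees_iff_card[OF G]]
  note S' = S[unfolded spanning_trees_iff_card[OF fH]]
  note TU' = TU[unfolded spanning_trees_iff_card[OF fH]]
  have fin: "finite T" "finite S"
    using T' S' finite_mgraphD(2)[OF G] finite_mgraphD(2)[OF fH] by (auto intro: finite_subset)
  have "conn_rel ?d T \<subseteq> conn_rel ?d ?T"
  proof (rule conn_rel_subsetI)
    fix e u v assume e: "e \<in> T" "?d e = {u, v}"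
    show "(u, v) \<in> conn_rel ?d ?T"
    proof (cases "e \<in> edges ?H")
      case True
      then have "(u, v) \<in> U \<times> U" using e(2) by (auto simp: H)
      then have "(u, v) \<in> conn_rel ?d S" using S' unfolding H by blast
      then show ?thesis using conn_rel_mono[of S ?T ?d] by blast
    next
      case False
      then show ?thesis using e by (intro conn_rel_edge[of e]) auto
    qed
  qed
  then have "verts G \<times> verts G \<subseteq> conn_rel ?d ?T" using T' by blast
  moreover have "card ?T = card T"
  proof -
    have "card ?T = card (T - edges ?H) + card S"
      using fin S' by (intro card_Un_disjoint) auto
    moreover have "card T = card (T \<inter> edges ?H) + card (T - edges ?H)"
      using fin(1) by (rule card_Int_Diff)
    ultimately show ?thesis using S' TU' by linarith
  qed
  moreover have "?T \<subseteq> edges G" using T' S' by (auto simp: H)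
  ultimately show ?thesis unfolding spanning_trees_iff_card[OF G] using T' by simp
qed

subsection \<open>Optimal edge usage\<close>

text \<open>The pmfs supported on \<open>A\<close> form the standard simplex, which is compact in
  the product topology, so a continuous function attains its minimum there.\<close>

lemma exists_pmf_minimizing:
  fixes f :: "('a \<Rightarrow> real) \<Rightarrow> real"
  assumes A: "finite A" "A \<noteq> {}" and f: "continuous_on UNIV f"
  shows "\<exists>\<mu>. set_pmf \<mu> \<subseteq> A \<and> (\<forall>\<nu>. set_pmf \<nu> \<subseteq> A \<longrightarrow> f (pmf \<mu>) \<le> f (pmf \<nu>))"
proof -
  \<comment> \<open>The simplex is written as a box, compact by Tychonoff, cut by a closed
    hyperplane; coordinates outside \<open>A\<close> are pinned to 0.\<close>
  define C :: "('a \<Rightarrow> real) set" where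
    "C = (\<Pi>\<^sub>E x\<in>UNIV. if x \<in> A then {0..1} else {0}) \<inter> {p. sum p A = 1}"
  have mem: "p \<in> C \<longleftrightarrow> (\<forall>x. 0 \<le> p x) \<and> (\<forall>x. x \<notin> A \<longrightarrow> p x = 0) \<and> sum p A = 1" for p
  proof
    assume p: "(\<forall>x. 0 \<le> p x) \<and> (\<forall>x. x \<notin> A \<longrightarrow> p x = 0) \<and> sum p A = 1"
    then have "p x \<le> 1" if "x \<in> A" for x
      using member_le_sum[of x A p] that A(1) by auto
    with p show "p \<in> C" by (auto simp: C_def PiE_def Pi_def extensional_def)
  next
    assume "p \<in> C"
    then have p: "p x \<in> (if x \<in> A then {0..1} else {0})" "sum p A = 1" for x
      by (auto simp: C_def PiE_def Pi_def)
    have "0 \<le> p x" "x \<notin> A \<longrightarrow> p x = 0" for x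
      using p(1)[of x] by (auto split: if_splits)
    with p(2) show "(\<forall>x. 0 \<le> p x) \<and> (\<forall>x. x \<notin> A \<longrightarrow> p x = 0) \<and> sum p A = 1" by blast
  qed
  have pmf_C: "pmf \<nu> \<in> C" if "set_pmf \<nu> \<subseteq> A" for \<nu>
    using that sum_pmf_eq_1[OF A(1) that] by (auto simp: mem pmf_eq_0_set_pmf)
  have "compact (\<Pi>\<^sub>E x\<in>UNIV. if x \<in> A then {0..1::real} else {0})"
  proof -
    have "compactin (product_topology (\<lambda>_. euclidean) UNIV) (\<Pi>\<^sub>E x\<in>UNIV. if x \<in> A then {0..1::real} else {0})"
      unfolding compactin_PiE by simp
    then show ?thesis
      by (simp add: euclidean_product_topology)
  qed
  moreover have "closed {p :: 'a \<Rightarrow> real. sum p A = 1}"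
    by (intro closed_Collect_eq continuous_intros continuous_on_product_coordinates)
  ultimately have "compact C"
    unfolding C_def by (rule compact_Int_closed)
  moreover have "C \<noteq> {}"
    using A(2) pmf_C[of "return_pmf (SOME x. x \<in> A)"] some_in_eq[of A] by auto
  ultimately obtain p where p: "p \<in> C" "\<And>q. q \<in> C \<Longrightarrow> f p \<le> f q"
    using continuous_attains_inf[of C f] continuous_on_subset[OF f subset_UNIV] by blast
  \<comment> \<open>To turn the minimizing point back into a pmf, its total mass over the whole type
    must be 1.\<close>
  have "(\<integral>\<^sup>+x. ennreal (p x) \<partial>count_space UNIV) = (\<Sum>x\<in>A. ennreal (p x))"
    using A(1) p(1) by (intro nn_integral_count_space'[of A]) (auto simp: mem)
  also have "\<dots> = 1"
    using p(1) by (simp add: mem sum_ennreal)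
  finally have "pmf (embed_pmf p) x = p x" for x
    using p(1) by (intro pmf_embed_pmf) (auto simp: mem)
  then have "pmf (embed_pmf p) = p" by (rule ext)
  moreover from this have "set_pmf (embed_pmf p) \<subseteq> A"
    using p(1) by (auto simp: mem set_pmf_eq)
  ultimately show ?thesis
    using p(2) pmf_C by (intro exI[of _ "embed_pmf p"]) simp
qed

section \<open>Usages as probabilities and expectations\<close>

text \<open>As probabilities, usages can be computed through \<open>map_pmf\<close> and
  \<open>pair_pmf\<close>.\<close>

lemma edge_usage_eq_prob:
  assumes "finite_mgraph G" "set_pmf \<mu> \<subseteq> spanning_trees G"
  shows "edge_usage G \<mu> e = measure_pmf.prob \<mu> {T. e \<in> T}"
proof -
  have "edge_usage G \<mu> e = measure_pmf.prob \<mu> {T \<in> spanning_trees G. e \<in> T}"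
    unfolding edge_usage_def
    using finite_spanning_trees[OF assms(1)] by (subst measure_measure_pmf_finite) auto
  also have "\<dots> = measure_pmf.prob \<mu> ({T \<in> spanning_trees G. e \<in> T} \<inter> set_pmf \<mu>)"
    by (simp add: measure_Int_set_pmf)
  also have "{T \<in> spanning_trees G. e \<in> T} \<inter> set_pmf \<mu> = {T. e \<in> T} \<inter> set_pmf \<mu>"
    using assms(2) by auto
  finally show ?thesis by (simp add: measure_Int_set_pmf)
qed

lemma edge_usage_nonedge: "e \<notin> edges G \<Longrightarrow> edge_usage G \<mu> e = 0"
  unfolding edge_usage_def by (rule sum.neutral) (auto simp: spanning_trees_def)

text \<open>Double counting of pairs of an edge and a tree containing it; for \<open>\<mu>\<close>
  supported on spanning trees the value is the expected weight of a random tree.\<close>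

lemma sum_weight_edge_usage:
  assumes G: "finite_mgraph G"
  shows "(\<Sum>e\<in>edges G. w e * edge_usage G \<mu> e) = (\<Sum>T\<in>spanning_trees G. pmf \<mu> T * sum w T)"
proof -
  note fin = finite_spanning_trees[OF G] finite_mgraphD(2)[OF G]
  have "(\<Sum>e\<in>edges G. w e * edge_usage G \<mu> e) =
      (\<Sum>e\<in>edges G. \<Sum>T\<in>spanning_trees G. if e \<in> T then pmf \<mu> T * w e else 0)"
    unfolding edge_usage_def sum.inter_filter[OF fin(1), symmetric] sum_distrib_left
    by (simp add: mult.commute)
  also have "\<dots> = (\<Sum>T\<in>spanning_trees G. \<Sum>e\<in>edges G. if e \<in> T then pmf \<mu> T * w e else 0)"
    by (rule sum.swap)
  also have "\<dots> = (\<Sum>T\<in>spanning_trees G. pmf \<mu> T * sum w T)"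
  proof (rule sum.cong[OF refl])
    fix T assume "T \<in> spanning_trees G"
    then have "{e \<in> edges G. e \<in> T} = T" by (auto simp: spanning_trees_def)
    then show "(\<Sum>e\<in>edges G. if e \<in> T then pmf \<mu> T * w e else 0) = pmf \<mu> T * sum w T"
      by (simp add: sum.inter_filter[OF fin(2), symmetric] sum_distrib_left)
  qed
  finally show ?thesis .
qed

lemma sum_edge_usage:
  assumes G: "finite_mgraph G" and K: "K \<subseteq> edges G"
  shows "(\<Sum>e\<in>K. edge_usage G \<mu> e) = (\<Sum>T\<in>spanning_trees G. pmf \<mu> T * real (card (T \<inter> K)))"
proof -
  note finE = finite_mgraphD(2)[OF G]
  have "(\<Sum>e\<in>K. edge_usage G \<mu> e) = (\<Sum>e\<in>edges G. indicator K e * edge_usage G \<mu> e)"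
    using K finE by (simp add: indicator_def if_distrib[of "\<lambda>x. x * _"] sum.inter_restrict[OF finE, symmetric] Int_absorb1 cong: if_cong)
  also have "\<dots> = (\<Sum>T\<in>spanning_trees G. pmf \<mu> T * sum (indicator K) T)"
    by (rule sum_weight_edge_usage[OF G])
  also have "\<dots> = (\<Sum>T\<in>spanning_trees G. pmf \<mu> T * real (card (T \<inter> K)))"
  proof (rule sum.cong[OF refl])
    fix T assume "T \<in> spanning_trees G"
    then have "finite T" using finE by (auto simp: spanning_trees_def intro: finite_subset)
    then show "pmf \<mu> T * sum (indicator K) T = pmf \<mu> T * real (card (T \<inter> K))"
      by (simp add: indicator_def sum.If_cases Int_def)
  qed
  finally show ?thesis .
qed

section \<open>Minimizers: existence, first-order condition, uniqueness\<close>

lemma exists_pmf_mixture: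
  fixes \<mu> \<nu> :: "'a pmf"
  assumes "0 \<le> t" "t \<le> 1"
  obtains \<rho> where "set_pmf \<rho> \<subseteq> set_pmf \<mu> \<union> set_pmf \<nu>"
    "\<And>x. pmf \<rho> x = (1 - t) * pmf \<mu> x + t * pmf \<nu> x"
proof
  let ?\<rho> = "bind_pmf (bernoulli_pmf t) (\<lambda>b. if b then \<nu> else \<mu>)"
  show "set_pmf ?\<rho> \<subseteq> set_pmf \<mu> \<union> set_pmf \<nu>" by (auto split: if_splits)
  show "pmf ?\<rho> x = (1 - t) * pmf \<mu> x + t * pmf \<nu> x" for x
    using assms by (simp add: pmf_bind mult.commute)
qed

lemma feu_minimizer_iff:
  "feu_minimizer G \<mu> \<longleftrightarrow> set_pmf \<mu> \<subseteq> spanning_trees G \<and> (\<forall>\<nu>. set_pmf \<nu> \<subseteq> spanning_trees G \<longrightarrow>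
     (\<Sum>e\<in>edges G. (edge_usage G \<mu> e)\<^sup>2) \<le> (\<Sum>e\<in>edges G. (edge_usage G \<nu> e)\<^sup>2))"
  unfolding feu_minimizer_def is_arg_min_linorder by blast

lemma feu_minimizer_exists:
  assumes G: "finite_mgraph G" and conn: "connected_mgraph G"
  shows "\<exists>\<mu>. feu_minimizer G \<mu>"
proof -
  let ?f = "\<lambda>p. \<Sum>e\<in>edges G. (\<Sum>T\<in>{T \<in> spanning_trees G. e \<in> T}. p T)\<^sup>2 :: real"
  have "continuous_on UNIV ?f"
    by (intro continuous_intros continuous_on_product_coordinates)
  then show ?thesis
    using exists_pmf_minimizing[OF finite_spanning_trees[OF G] spanning_trees_nonempty[OF G conn], of ?f]
    unfolding feu_minimizer_iff edge_usage_def by blast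
qed

text \<open>First-order optimality along the segment from \<open>\<mu>\<close> to \<open>\<nu>\<close>.\<close>

lemma feu_minimizer_variational:
  assumes G: "finite_mgraph G" and \<mu>: "feu_minimizer G \<mu>" and \<nu>: "set_pmf \<nu> \<subseteq> spanning_trees G"
  shows "(\<Sum>e\<in>edges G. (edge_usage G \<mu> e)\<^sup>2) \<le> (\<Sum>e\<in>edges G. edge_usage G \<mu> e * edge_usage G \<nu> e)"
proof (rule ccontr)
  let ?a = "edge_usage G \<mu>" and ?b = "edge_usage G \<nu>"
  define D where "D = (\<Sum>e\<in>edges G. ?a e * ?b e) - (\<Sum>e\<in>edges G. (?a e)\<^sup>2)"
  define C where "C = (\<Sum>e\<in>edges G. (?b e - ?a e)\<^sup>2)"
  assume "\<not> ?thesis"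
  then have D: "D < 0" by (simp add: D_def)
  have C: "C \<ge> 0" by (simp add: C_def sum_nonneg)
  \<comment> \<open>At parameter \<open>t\<close> the objective changes by
    \<open>2 * t * D + t\<^sup>2 * C\<close>. This \<open>t\<close> gives
    \<open>t * C \<le> - D\<close>, so the change is at most \<open>t * D < 0\<close>; the 1 added
    to \<open>C\<close> keeps the denominator positive.\<close>
  define t where "t = min 1 (- D / (C + 1))"
  have t: "0 < t" "t \<le> 1" using D C by (auto simp: t_def divide_neg_pos)
  obtain \<rho> where \<rho>: "set_pmf \<rho> \<subseteq> set_pmf \<mu> \<union> set_pmf \<nu>"
    "\<And>T. pmf \<rho> T = (1 - t) * pmf \<mu> T + t * pmf \<nu> T"
    using exists_pmf_mixture[of t \<mu> \<nu>] t by auto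
  have us: "edge_usage G \<rho> e = (1 - t) * ?a e + t * ?b e" for e
    unfolding edge_usage_def \<rho>(2) by (simp add: sum.distrib sum_distrib_left)
  have "set_pmf \<rho> \<subseteq> spanning_trees G" using \<rho>(1) \<mu> \<nu> by (auto simp: feu_minimizer_iff)
  then have "(\<Sum>e\<in>edges G. (?a e)\<^sup>2) \<le> (\<Sum>e\<in>edges G. ((1 - t) * ?a e + t * ?b e)\<^sup>2)"
    using \<mu> unfolding feu_minimizer_iff us[symmetric] by blast
  also have "\<dots> = (\<Sum>e\<in>edges G. (?a e)\<^sup>2 + 2 * t * (?a e * ?b e - (?a e)\<^sup>2) + t\<^sup>2 * (?b e - ?a e)\<^sup>2)"
    by (rule sum.cong) (auto simp: power2_eq_square algebra_simps)
  also have "\<dots> = (\<Sum>e\<in>edges G. (?a e)\<^sup>2) + 2 * t * D + t\<^sup>2 * C"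
    unfolding D_def C_def by (simp add: sum.distrib sum_subtractf flip: sum_distrib_left)
  finally have "0 \<le> t * (2 * D + t * C)" by (simp add: power2_eq_square algebra_simps)
  then have "0 \<le> 2 * D + t * C" using t(1) by (simp add: zero_le_mult_iff)
  moreover have "t * C \<le> - D"
  proof -
    have "t * C \<le> t * (C + 1)" using t(1) by simp
    also have "\<dots> \<le> (- D / (C + 1)) * (C + 1)" using C by (intro mult_right_mono) (auto simp: t_def)
    also have "\<dots> = - D" using C by simp
    finally show ?thesis .
  qed
  ultimately show False using D by simp
qed

text \<open>Adding the first-order inequalities of the two minimizers bounds the squared distance of
  their usages by 0. Off the edge set both vanish, so they agree as functions, as the definite
  description requires.\<close>

lemma feu_minimizer_edge_usage_unique:
  assumes G: "finite_mgraph G" and \<mu>: "feu_minimizer G \<mu>" and \<nu>: "feu_minimizer G \<nu>"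
  shows "edge_usage G \<mu> = edge_usage G \<nu>"
proof
  fix e
  let ?a = "edge_usage G \<mu>" and ?b = "edge_usage G \<nu>"
  have "(\<Sum>e\<in>edges G. (?a e - ?b e)\<^sup>2) = (\<Sum>e\<in>edges G. (?a e)\<^sup>2 - ?a e * ?b e + ((?b e)\<^sup>2 - ?b e * ?a e))"
    by (rule sum.cong) (auto simp: power2_eq_square algebra_simps)
  also have "\<dots> \<le> 0"
    unfolding sum.distrib sum_subtractf
    using feu_minimizer_variational[OF G \<mu>, of \<nu>] feu_minimizer_variational[OF G \<nu>, of \<mu>] \<mu> \<nu>
    by (simp add: feu_minimizer_iff)
  finally have "(\<Sum>e\<in>edges G. (?a e - ?b e)\<^sup>2) = 0"
    by (intro antisym sum_nonneg) auto
  then have "\<forall>e\<in>edges G. (?a e - ?b e)\<^sup>2 = 0"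
    using finite_mgraphD(2)[OF G] by (subst (asm) sum_nonneg_eq_0_iff) auto
  then show "?a e = ?b e" by (cases "e \<in> edges G") (auto simp: edge_usage_nonedge)
qed

lemma optimal_edge_usage_eq:
  assumes "finite_mgraph G" "feu_minimizer G \<mu>"
  shows "optimal_edge_usage G = edge_usage G \<mu>"
  unfolding optimal_edge_usage_def
  using assms feu_minimizer_edge_usage_unique[OF assms(1)] by (intro the_equality) blast+

section \<open>Charged trees and critical sets\<close>

text \<open>The first-order inequality against a point mass shows that every tree weighs at least
  \<open>c\<close>, the optimal value. The mean weight under \<open>\<mu>\<close> is
  \<open>c\<close> itself, so every charged tree weighs exactly \<open>c\<close>.\<close>

lemma feu_minimizer_support_min_weight:
  assumes G: "finite_mgraph G" and \<mu>: "feu_minimizer G \<mu>" and T: "T \<in> set_pmf \<mu>"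
    and S: "S \<in> spanning_trees G"
  shows "sum (edge_usage G \<mu>) T \<le> sum (edge_usage G \<mu>) S"
proof -
  let ?\<eta> = "edge_usage G \<mu>" and ?\<Omega> = "spanning_trees G"
  define c where "c = (\<Sum>e\<in>edges G. (?\<eta> e)\<^sup>2)"
  have fin: "finite ?\<Omega>" by (rule finite_spanning_trees[OF G])
  have supp: "set_pmf \<mu> \<subseteq> ?\<Omega>" using \<mu> by (simp add: feu_minimizer_iff)
  have le: "c \<le> sum ?\<eta> R" if R: "R \<in> ?\<Omega>" for R
  proof -
    have "c \<le> (\<Sum>e\<in>edges G. ?\<eta> e * edge_usage G (return_pmf R) e)"
      unfolding c_def using R by (intro feu_minimizer_variational[OF G \<mu>]) simp
    also have "\<dots> = (\<Sum>Q\<in>?\<Omega>. pmf (return_pmf R) Q * sum ?\<eta> Q)"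
      by (rule sum_weight_edge_usage[OF G])
    also have "\<dots> = sum ?\<eta> R"
      using R fin by (subst sum.remove[of _ R]) (auto intro!: sum.neutral)
    finally show ?thesis .
  qed
  have "(\<Sum>R\<in>?\<Omega>. pmf \<mu> R * (sum ?\<eta> R - c)) = (\<Sum>R\<in>?\<Omega>. pmf \<mu> R * sum ?\<eta> R) - c * (\<Sum>R\<in>?\<Omega>. pmf \<mu> R)"
    by (simp add: sum_subtractf right_diff_distrib sum_distrib_left mult.commute)
  also have "\<dots> = 0"
    unfolding sum_weight_edge_usage[OF G, symmetric] sum_pmf_eq_1[OF fin supp]
    by (simp add: c_def power2_eq_square)
  finally have "\<forall>R\<in>?\<Omega>. pmf \<mu> R * (sum ?\<eta> R - c) = 0"
    using fin le by (subst sum_nonneg_eq_0_iff[symmetric]) (auto simp: pmf_nonneg)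
  then have "sum ?\<eta> T = c" using T supp by (auto simp: set_pmf_eq)
  then show ?thesis using le[OF S] by simp
qed

lemma min_overlap_le:
  assumes "finite_mgraph G" "S \<in> spanning_trees G"
  shows "min_overlap G K \<le> card (S \<inter> K)"
  unfolding min_overlap_def using assms finite_spanning_trees[OF assms(1)] by (intro Min_le) auto

lemma edge_usage_le_theta_graph:
  assumes G: "finite_mgraph G" and \<mu>: "feu_minimizer G \<mu>" and e: "e \<in> edges G"
  shows "edge_usage G \<mu> e \<le> theta_graph G"
proof -
  let ?\<eta> = "edge_usage G \<mu>" and ?\<Omega> = "spanning_trees G"
  define m where "m = Max (?\<eta> ` edges G)"
  define K where "K = {e \<in> edges G. ?\<eta> e = m}"
  have fin: "finite ?\<Omega>" "finite (edges G)"
    using finite_spanning_trees[OF G] finite_mgraphD(2)[OF G] .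
  have supp: "set_pmf \<mu> \<subseteq> ?\<Omega>" using \<mu> by (simp add: feu_minimizer_iff)
  have le_m: "?\<eta> f \<le> m" if "f \<in> edges G" for f
    using that fin(2) by (simp add: m_def)
  have "m \<in> ?\<eta> ` edges G" unfolding m_def using e fin(2) by (intro Max_in) auto
  then have K: "K \<subseteq> edges G" "K \<noteq> {}" "finite K" using fin(2) by (auto simp: K_def)
  have supp_min: "card (T \<inter> K) = min_overlap G K" if T: "T \<in> set_pmf \<mu>" for T
    unfolding min_overlap_def
  proof (rule Min_eqI[symmetric])
    have T\<Omega>: "T \<in> ?\<Omega>" using T supp by auto
    show "card (T \<inter> K) \<in> (\<lambda>T. card (T \<inter> K)) ` ?\<Omega>" using T\<Omega> by auto
    show "card (T \<inter> K) \<le> y" if "y \<in> (\<lambda>T. card (T \<inter> K)) ` ?\<Omega>" for y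
      using that min_weight_spanning_tree_heaviest_edges[OF G T\<Omega> feu_minimizer_support_min_weight[OF G \<mu> T] le_m]
      unfolding K_def by auto
  qed (simp add: fin)
  \<comment> \<open>The usage on \<open>K\<close> is summed in two ways: each edge contributes
    \<open>m\<close>, and each charged tree meets \<open>K\<close> in exactly
    \<open>min_overlap G K\<close> edges.\<close>
  have "m * real (card K) = (\<Sum>e\<in>K. ?\<eta> e)"
    by (simp add: K_def)
  also have "\<dots> = (\<Sum>T\<in>?\<Omega>. pmf \<mu> T * real (card (T \<inter> K)))"
    by (rule sum_edge_usage[OF G K(1)])
  also have "\<dots> = (\<Sum>T\<in>?\<Omega>. pmf \<mu> T * real (min_overlap G K))"
    using supp_min by (intro sum.cong) (auto simp: set_pmf_eq)
  also have "\<dots> = real (min_overlap G K)"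
    using sum_pmf_eq_1[OF fin(1) supp] by (simp add: sum_distrib_right[symmetric])
  finally have "m = theta_set G K"
    using K by (simp add: theta_set_def field_simps)
  also have "\<dots> \<le> theta_graph G"
    unfolding theta_graph_def using fin(2) K(1) by (intro Max_ge) auto
  finally show ?thesis using le_m[OF e] by simp
qed

text \<open>For nonempty \<open>J\<close> the usage bound caps the mean overlap with
  \<open>J\<close> at its minimum \<open>M\<close>. No tree has overlap below \<open>M\<close>, so
  no charged tree lies above it.\<close>

lemma feu_minimizer_support_min_overlap:
  assumes G: "finite_mgraph G" and \<mu>: "feu_minimizer G \<mu>" and J: "critical_set G J"
    and T: "T \<in> set_pmf \<mu>" and S: "S \<in> spanning_trees G"
  shows "card (T \<inter> J) \<le> card (S \<inter> J)"
proof (cases "J = {}")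
  case False
  let ?\<Omega> = "spanning_trees G"
  define M where "M = min_overlap G J"
  have fin: "finite ?\<Omega>" "finite (edges G)"
    using finite_spanning_trees[OF G] finite_mgraphD(2)[OF G] .
  have supp: "set_pmf \<mu> \<subseteq> ?\<Omega>" using \<mu> by (simp add: feu_minimizer_iff)
  have JE: "J \<subseteq> edges G" "theta_graph G = theta_set G J" using J by (auto simp: critical_set_def)
  then have fJ: "finite J" using fin(2) by (auto intro: finite_subset)
  have M_le: "real M \<le> real (card (R \<inter> J))" if "R \<in> ?\<Omega>" for R
    using min_overlap_le[OF G that] by (simp add: M_def)
  have "(\<Sum>R\<in>?\<Omega>. pmf \<mu> R * real (card (R \<inter> J))) = (\<Sum>e\<in>J. edge_usage G \<mu> e)"
    by (rule sum_edge_usage[OF G JE(1), symmetric])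
  also have "\<dots> \<le> (\<Sum>e\<in>J. theta_graph G)"
    using JE(1) by (intro sum_mono edge_usage_le_theta_graph[OF G \<mu>]) auto
  \<comment> \<open>By criticality each of the \<open>card J\<close> terms equals
    \<open>M / card J\<close>.\<close>
  also have "\<dots> = real M"
    using False fJ by (simp add: JE(2) theta_set_def M_def)
  finally have "(\<Sum>R\<in>?\<Omega>. pmf \<mu> R * (real (card (R \<inter> J)) - real M)) \<le> 0"
    using sum_pmf_eq_1[OF fin(1) supp]
    by (simp add: sum_subtractf right_diff_distrib sum_distrib_right[symmetric])
  moreover have nn: "0 \<le> pmf \<mu> R * (real (card (R \<inter> J)) - real M)" if "R \<in> ?\<Omega>" for R
    using M_le[OF that] by (simp add: pmf_nonneg)
  ultimately have "\<forall>R\<in>?\<Omega>. pmf \<mu> R * (real (card (R \<inter> J)) - real M) = 0"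
    using fin(1) by (subst sum_nonneg_eq_0_iff[symmetric]) (auto intro: antisym sum_nonneg)
  then have "card (T \<inter> J) = M" using T supp by (auto simp: set_pmf_eq)
  then show ?thesis using min_overlap_le[OF G S, of J] by (simp add: M_def)
qed simp

text \<open>Any competitor \<open>\<nu>\<close> on the subgraph can be transplanted into \<open>\<mu>\<close>, independently of the part of
  the tree outside the subgraph, without changing the usage there.\<close>

lemma feu_minimizer_restrict:
  assumes G: "finite_mgraph G" and \<mu>: "feu_minimizer G \<mu>" and U: "U \<subseteq> verts G"
    and restr: "\<And>T. T \<in> set_pmf \<mu> \<Longrightarrow>
      T \<inter> edges (induced_mgraph G U) \<in> spanning_trees (induced_mgraph G U)"
  defines "\<mu>' \<equiv> map_pmf (\<lambda>T. T \<inter> edges (induced_mgraph G U)) \<mu>"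
  shows "feu_minimizer (induced_mgraph G U) \<mu>'"
    and "e \<in> edges (induced_mgraph G U) \<Longrightarrow> edge_usage (induced_mgraph G U) \<mu>' e = edge_usage G \<mu> e"
proof -
  let ?H = "induced_mgraph G U"
  let ?F = "edges ?H"
  have fH: "finite_mgraph ?H" using G U by (rule finite_mgraph_induced)
  have FE: "?F \<subseteq> edges G" by (auto simp: induced_mgraph_def)
  have supp: "set_pmf \<mu> \<subseteq> spanning_trees G" using \<mu> by (simp add: feu_minimizer_iff)
  have supp': "set_pmf \<mu>' \<subseteq> spanning_trees ?H" using restr by (auto simp: \<mu>'_def)
  show us: "edge_usage ?H \<mu>' e = edge_usage G \<mu> e" if "e \<in> ?F" for e
    unfolding edge_usage_eq_prob[OF G supp] edge_usage_eq_prob[OF fH supp']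
    using that by (simp add: \<mu>'_def)
  show "feu_minimizer ?H \<mu>'"
    unfolding feu_minimizer_iff
  proof (intro conjI allI impI supp')
    fix \<nu> assume \<nu>: "set_pmf \<nu> \<subseteq> spanning_trees ?H"
    let ?g = "\<lambda>(T, S). (T - ?F) \<union> S"
    \<comment> \<open>\<open>T\<close> and \<open>S\<close> are drawn independently, and the part of
      \<open>T\<close> inside the subgraph is replaced by \<open>S\<close>.\<close>
    define \<rho> where "\<rho> = map_pmf ?g (pair_pmf \<mu> \<nu>)"
    have supp_\<rho>: "set_pmf \<rho> \<subseteq> spanning_trees G"
      using spanning_tree_replace[OF G _ U restr] supp \<nu> by (auto simp: \<rho>_def)
    have S: "S \<subseteq> ?F" if "S \<in> set_pmf \<nu>" for S
      using that \<nu> by (auto simp: spanning_trees_def)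
    have prob: "edge_usage G \<rho> f = measure_pmf.prob (pair_pmf \<mu> \<nu>) {p. f \<in> ?g p}" for f
      unfolding edge_usage_eq_prob[OF G supp_\<rho>] by (simp add: \<rho>_def vimage_def)
    have in_F: "edge_usage G \<rho> f = edge_usage ?H \<nu> f" if f: "f \<in> ?F" for f
    proof -
      have "edge_usage G \<rho> f = measure_pmf.prob (pair_pmf \<mu> \<nu>) {p. f \<in> snd p}"
        unfolding prob using f by (intro arg_cong2[of _ _ _ _ measure]) auto
      also have "\<dots> = measure_pmf.prob (map_pmf snd (pair_pmf \<mu> \<nu>)) {S. f \<in> S}"
        by (simp add: vimage_def)
      finally show ?thesis
        unfolding map_snd_pair_pmf edge_usage_eq_prob[OF fH \<nu>] .
    qed
    have out_F: "edge_usage G \<rho> f = edge_usage G \<mu> f" if f: "f \<notin> ?F" for f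
    proof -
      \<comment> \<open>Only for charged \<open>S\<close> is \<open>S \<subseteq> ?F\<close> known,
        so the event is first cut down to the support.\<close>
      have "edge_usage G \<rho> f = measure_pmf.prob (pair_pmf \<mu> \<nu>) ({p. f \<in> ?g p} \<inter> set_pmf (pair_pmf \<mu> \<nu>))"
        unfolding prob measure_Int_set_pmf ..
      also have "{p. f \<in> ?g p} \<inter> set_pmf (pair_pmf \<mu> \<nu>) = {p. f \<in> fst p} \<inter> set_pmf (pair_pmf \<mu> \<nu>)"
        using f S by auto
      also have "measure_pmf.prob (pair_pmf \<mu> \<nu>) \<dots> = measure_pmf.prob (map_pmf fst (pair_pmf \<mu> \<nu>)) {T. f \<in> T}"
        unfolding measure_Int_set_pmf by (simp add: vimage_def)
      finally show ?thesis
        unfolding map_fst_pair_pmf edge_usage_eq_prob[OF G supp] .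
    qed
    \<comment> \<open>Usages under \<open>\<rho>\<close> and \<open>\<mu>\<close> agree off
      \<open>?F\<close>; those terms cancel, and optimality of \<open>\<mu>\<close> in
      \<open>G\<close> becomes the comparison on \<open>?F\<close>.\<close>
    have split: "(\<Sum>f\<in>edges G. h f) = (\<Sum>f\<in>edges G - ?F. h f) + (\<Sum>f\<in>?F. h f)" for h :: "'b \<Rightarrow> real"
      using FE finite_mgraphD(2)[OF G] by (rule sum.subset_diff)
    have "(\<Sum>f\<in>edges G. (edge_usage G \<mu> f)\<^sup>2) \<le> (\<Sum>f\<in>edges G. (edge_usage G \<rho> f)\<^sup>2)"
      using \<mu> supp_\<rho> by (simp add: feu_minimizer_iff)
    then show "(\<Sum>f\<in>?F. (edge_usage ?H \<mu>' f)\<^sup>2) \<le> (\<Sum>f\<in>?F. (edge_usage ?H \<nu> f)\<^sup>2)"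
      unfolding split by (simp add: us in_F out_F)
  qed
qed

theorem theorem10:
  fixes G :: "('v, 'e) mgraph" and J :: "'e set" and U :: "'v set" and e :: 'e
  assumes "finite_mgraph G"
    and "connected_mgraph G"
    and "edges G \<noteq> {}"
    and "critical_set G J"
    and "U \<in> component_verts (G\<lparr>edges := edges G - J\<rparr>)"
    and "e \<in> edges (induced_mgraph G U)"
  shows "optimal_edge_usage G e = optimal_edge_usage (induced_mgraph G U) e"
proof -
  note G = assms(1)
  obtain \<mu> where \<mu>: "feu_minimizer G \<mu>"
    using feu_minimizer_exists[OF G assms(2)] by blast
  have U: "U \<subseteq> verts G" by (rule component_vertsD(2)[OF assms(5)])
  have restr: "T \<inter> edges (induced_mgraph G U) \<in> spanning_trees (induced_mgraph G U)" if T: "T \<in> set_pmf \<mu>" for T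
    using T \<mu> feu_minimizer_support_min_overlap[OF G \<mu> assms(4) T]
    by (intro spanning_tree_restrict[OF G _ _ assms(5)]) (auto simp: feu_minimizer_iff)
  note min = feu_minimizer_restrict[OF G \<mu> U restr]
  have "optimal_edge_usage G e = edge_usage G \<mu> e"
    using optimal_edge_usage_eq[OF G \<mu>] by simp
  also have "\<dots> = optimal_edge_usage (induced_mgraph G U) e"
    using optimal_edge_usage_eq[OF finite_mgraph_induced[OF G U] min(1)] min(2)[OF _ assms(6)] by simp
  finally show ?thesis .
qed

end
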